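(* Let $N\ge1$ be an integer and let $\alpha,\beta\in\mathbb C$ satisfy $\alpha+1\notin\{0,-1,\dots,-(N-1)\}$ and $\alpha+\beta+j\ne0$ for $j=2,3,\dots,2N$. Let $P_n=P_n(x;\alpha,\beta,N)$, $0\le n\le N$, be the monic Hahn polynomials, viewed as functions on the grid $\{0,1,\dots,N\}$, with $P_{-1}=0$ and $P_{N+1}=0$ on the grid. Let $\lambda_n=n(n+\alpha+\beta+1)$, and let $b_n,u_n$ be the recurrence coefficients in $xP_n=P_{n+1}+b_nP_n+u_nP_{n-1}$ (with $u_0=0$). (1) For all $\tau_0,\dots,\tau_4\in\mathbb C$, the operator $W=\tau_1XY+\tau_2YX+\tau_3X+\tau_4Y+\tau_0\mathcal I$ is tridiagonal with respect to the Hahn polynomials: for $n=0,1,\dots,N$, $$WP_n=\xi_{n+1}P_{n+1}+\eta_nP_n+\zeta_nu_nP_{n-1},$$ where $$\xi_n=\tau_1\lambda_{n-1}+\tau_2\lambda_n+\tau_3,\qquad \zeta_n=\tau_2\lambda_{n-1}+\tau_1\lambda_n+\tau_3,$$ $$\eta_n=(\tau_1+\tau_2)\lambda_nb_n+\tau_3b_n+\tau_4\lambda_n+\tau_0 .$$ (2) Conversely, if $W=A_1(x)T^{+}+A_2(x)T^{-}+A_0(x)\mathcal I$ is any second order difference operator on the grid $\{0,1,\dots,N\}$ such that for every $n=0,\dots,N$ the function $WP_n$ is a linear combination of $P_{n+1},P_n,P_{n-1}$, then there exist constants $\kappa,\mu_0,\mu_1,\nu_0,\nu_1,r_0,r_1\in\mathbb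 C$ such that on the grid $$A_1(x)=(x-N)(\kappa x^2+\mu_1x+\mu_0),\quad A_2(x)=x(\kappa x^2+\nu_1x+\nu_0),\quad A_0(x)=-A_1(x)-A_2(x)+r_1x+r_0 .$$
   Context: $T^{\pm}f(x)=f(x\pm1)$, $\mathcal I$ is the identity, $Xf(x)=xf(x)$, and $$Y=B(x)T^{+}+D(x)T^{-}-(B(x)+D(x))\mathcal I,\qquad B(x)=(x-N)(x+\alpha+1),\quad D(x)=x(x-\beta-N-1).$$ The monic Hahn polynomials are $$P_n(x;\alpha,\beta,N)=\frac{(\alpha+1)_n(-N)_n}{(n+\alpha+\beta+1)_n}\;{}_3F_2\!\left({-n,\;n+\alpha+\beta+1,\;-x\atop \alpha+1,\;-N};1\right)=x^n+O(x^{n-1}),$$ where $(a)_n=a(a+1)\cdots(a+n-1)$ and the series is summed over $k=0,\dots,n$. As known facts: $YP_n=\lambda_nP_n$, and on the grid they satisfy a three-term recurrence $xP_n=P_{n+1}+b_nP_n+u_nP_{n-1}$ for $0\le n\le N$, which defines $b_n,u_n$. A second order difference operator on the grid is an operator $(Wf)(x)=A_1(x)f(x+1)+A_2(x)f(x-1)+A_0(x)f(x)$, $x\in\{0,\dots,N\}$, acting on functions $f:\{0,\dots,N\}\to\mathbb C$, where $A_0,A_1,A_2$ are functions on the grid with $A_1(N)=0$ and $A_2(0)=0$ (the terms with $f(N+1)$ and $f(-1)$ are understood to be $0$). *)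

theory Defs
  imports Complex_Main
begin

text \<open>
  Functions on the grid $0,\dots,N$ are represented by functions on the integers, of which only
  the values on \<open>{0..int N}\<close> are ever compared.  The integers serve as index type so that
  $f(x-1)$ and $P_{n-1}$ need no truncated subtraction.  The junk values $f(-1)$ and $f(N+1)$ do
  not matter on the grid, since the operators below have coefficients that vanish there.
\<close>

definition diff_op ::
  "(int \<Rightarrow> complex) \<Rightarrow> (int \<Rightarrow> complex) \<Rightarrow> (int \<Rightarrow> complex) \<Rightarrow> (int \<Rightarrow> complex) \<Rightarrow> int \<Rightarrow> complex"
  where "diff_op A1 A2 A0 f = (\<lambda>x. A1 x * f (x + 1) + A2 x * f (x - 1) + A0 x * f x)"

definition opX :: "(int \<Rightarrow> complex) \<Rightarrow> int \<Rightarrow> complex"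
  where "opX f = (\<lambda>x. of_int x * f x)"

definition coefB :: "complex \<Rightarrow> nat \<Rightarrow> int \<Rightarrow> complex"
  where "coefB \<alpha> N x = (of_int x - of_nat N) * (of_int x + \<alpha> + 1)"

definition coefD :: "complex \<Rightarrow> nat \<Rightarrow> int \<Rightarrow> complex"
  where "coefD \<beta> N x = of_int x * (of_int x - \<beta> - of_nat N - 1)"

definition opY :: "complex \<Rightarrow> complex \<Rightarrow> nat \<Rightarrow> (int \<Rightarrow> complex) \<Rightarrow> int \<Rightarrow> complex"
  where "opY \<alpha> \<beta> N =
    diff_op (coefB \<alpha> N) (coefD \<beta> N) (\<lambda>x. - (coefB \<alpha> N x + coefD \<beta> N x))"

definition opW :: "complex \<Rightarrow> complex \<Rightarrow> nat \<Rightarrow> complex \<Rightarrow> complex \<Rightarrow> complex \<Rightarrow> complex \<Rightarrow> complex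
    \<Rightarrow> (int \<Rightarrow> complex) \<Rightarrow> int \<Rightarrow> complex"
  where "opW \<alpha> \<beta> N \<tau>0 \<tau>1 \<tau>2 \<tau>3 \<tau>4 f = (\<lambda>x.
    \<tau>1 * opX (opY \<alpha> \<beta> N f) x + \<tau>2 * opY \<alpha> \<beta> N (opX f) x
    + \<tau>3 * opX f x + \<tau>4 * opY \<alpha> \<beta> N f x + \<tau>0 * f x)"

definition F32_partial :: "nat \<Rightarrow> complex \<Rightarrow> complex \<Rightarrow> complex \<Rightarrow> complex \<Rightarrow> complex \<Rightarrow> complex \<Rightarrow> complex"
  where "F32_partial n a b c d e z =
    (\<Sum>k=0..n. pochhammer a k * pochhammer b k * pochhammer c k
                / (pochhammer d k * pochhammer e k * fact k) * z ^ k)"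

definition hahn_poly :: "complex \<Rightarrow> complex \<Rightarrow> nat \<Rightarrow> nat \<Rightarrow> complex \<Rightarrow> complex"
  where "hahn_poly \<alpha> \<beta> N n x =
    pochhammer (\<alpha> + 1) n * pochhammer (- of_nat N) n / pochhammer (of_nat n + \<alpha> + \<beta> + 1) n
    * F32_partial n (- of_nat n) (of_nat n + \<alpha> + \<beta> + 1) (- x) (\<alpha> + 1) (- of_nat N) 1"

text \<open>
  Only $P_{-1}$ and $P_{N+1}$ are needed outside the range $0\le n\le N$; both are zero on the grid.
  (The hypergeometric formula itself is not usable for $n = N+1$, because $(-N)_{N+1} = 0$.)
\<close>

definition hahn :: "complex \<Rightarrow> complex \<Rightarrow> nat \<Rightarrow> int \<Rightarrow> int \<Rightarrow> complex"
  where "hahn \<alpha> \<beta> N n x =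
    (if 0 \<le> n \<and> n \<le> int N then hahn_poly \<alpha> \<beta> N (nat n) (of_int x) else 0)"

definition hahn_eigenvalue :: "complex \<Rightarrow> complex \<Rightarrow> int \<Rightarrow> complex"
  where "hahn_eigenvalue \<alpha> \<beta> n = of_int n * (of_int n + \<alpha> + \<beta> + 1)"

definition hahn_recurrence_coeffs ::
  "complex \<Rightarrow> complex \<Rightarrow> nat \<Rightarrow> (int \<Rightarrow> complex) \<Rightarrow> (int \<Rightarrow> complex) \<Rightarrow> bool"
  where "hahn_recurrence_coeffs \<alpha> \<beta> N b u \<longleftrightarrow> u 0 = 0 \<and>
    (\<forall>n\<in>{0..int N}. \<forall>x\<in>{0..int N}.
      of_int x * hahn \<alpha> \<beta> N n x =
        hahn \<alpha> \<beta> N (n + 1) x + b n * hahn \<alpha> \<beta> N n x + u n * hahn \<alpha> \<beta> N (n - 1) x)"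

end

(* For part (1), write phi_k(x) = (-x)_k. Then Y phi_k is a combination of phi_k and phi_{k-1}, so
   (Y - lambda_n) applied to the partial sums of the hypergeometric series telescopes and vanishes
   at k = n. Given Y P_n = lambda_n P_n, the formula is the recurrence applied to X P_n.
   For part (2), only the fact that W raises degrees by at most one matters: W P_0 gives that
   A_0 + A_1 + A_2 is linear, W P_1 that A_1 - A_2 is quadratic, and W P_2 that A_1 + A_2 is cubic;
   A_1(N) = A_2(0) = 0 then gives the factorisations. For N <= 2 interpolation suffices. *)
theory Submission
  imports Defs
begin

section \<open>The eigenvalue equation\<close>

text \<open>Prepares the values of (-y)_{k+1} at y = x, x + 1 and x - 1. The third identity compares
  the two ways of splitting (-x)_{k+2}; its factor x will be supplied by D(x), so nothing has to be
  divided by x.\<close>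

lemma pochhammer_Suc_split:
  fixes x :: complex
  shows "pochhammer (- x) (Suc k) = pochhammer (- x) k * (of_nat k - x)"
    and "pochhammer (- x - 1) (Suc k) = (- x - 1) * pochhammer (- x) k"
    and "x * pochhammer (1 - x) (Suc k) = - pochhammer (- x) (Suc k) * (of_nat k + 1 - x)"
proof -
  show "pochhammer (- x) (Suc k) = pochhammer (- x) k * (of_nat k - x)"
    by (simp add: pochhammer_Suc algebra_simps)
  show "pochhammer (- x - 1) (Suc k) = (- x - 1) * pochhammer (- x) k"
    by (simp add: pochhammer_rec)
  have "pochhammer (- x) (Suc (Suc k)) = - x * pochhammer (1 - x) (Suc k)"
    by (subst pochhammer_rec) (simp add: algebra_simps)
  moreover have "pochhammer (- x) (Suc (Suc k)) = pochhammer (- x) (Suc k) * (of_nat k + 1 - x)"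
    by (subst pochhammer_Suc) (simp add: algebra_simps)
  ultimately show "x * pochhammer (1 - x) (Suc k) = - pochhammer (- x) (Suc k) * (of_nat k + 1 - x)"
    by simp
qed

text \<open>Shows that Y is bidiagonal in the basis (-x)_k, with \<open>M\<close> in the role of N
  and diagonal entry lambda_{k+1}. The difference in the D-part, multiplied by x, collapses to -(k +
  1) (-x)_{k+1}; then every term is a multiple of (-x)_k and a polynomial identity remains.\<close>

lemma hahn_operator_pochhammer:
  fixes x \<alpha> \<beta> M :: complex
  shows "(x - M) * (x + \<alpha> + 1) * (pochhammer (- x - 1) (Suc k) - pochhammer (- x) (Suc k))
       + x * (x - \<beta> - M - 1) * (pochhammer (1 - x) (Suc k) - pochhammer (- x) (Suc k))
       = (of_nat k + 1) * (of_nat k + \<alpha> + \<beta> + 2) * pochhammer (- x) (Suc k)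
         - (of_nat k + 1) * (of_nat k - M) * (of_nat k + \<alpha> + 1) * pochhammer (- x) k"
proof -
  have "x * (x - \<beta> - M - 1) * (pochhammer (1 - x) (Suc k) - pochhammer (- x) (Suc k))
      = (x - \<beta> - M - 1) * (x * pochhammer (1 - x) (Suc k) - x * pochhammer (- x) (Suc k))"
    by (simp add: algebra_simps)
  also have "\<dots> = - (of_nat k + 1) * (x - \<beta> - M - 1) * pochhammer (- x) (Suc k)"
    unfolding pochhammer_Suc_split(3) by (simp add: algebra_simps)
  finally show ?thesis
    unfolding pochhammer_Suc_split(1,2) by (simp add: algebra_simps)
qed

section \<open>Coefficients and partial sums of the hypergeometric series\<close>

text \<open>The x-free part of the k-th hypergeometric term, so that the series becomes an expansion
  in the basis (-x)_k.\<close>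

definition hahn_coeff :: "complex \<Rightarrow> complex \<Rightarrow> nat \<Rightarrow> nat \<Rightarrow> nat \<Rightarrow> complex"
  where "hahn_coeff \<alpha> \<beta> N n k =
    pochhammer (- of_nat n) k * pochhammer (of_nat n + \<alpha> + \<beta> + 1) k
      / (pochhammer (\<alpha> + 1) k * pochhammer (- of_nat N) k * fact k)"

definition hahn_norm :: "complex \<Rightarrow> complex \<Rightarrow> nat \<Rightarrow> nat \<Rightarrow> complex"
  where "hahn_norm \<alpha> \<beta> N n =
    pochhammer (\<alpha> + 1) n * pochhammer (- of_nat N) n / pochhammer (of_nat n + \<alpha> + \<beta> + 1) n"

lemma hahn_expansion:
  assumes "n \<le> N"
  shows "hahn \<alpha> \<beta> N (int n) x = hahn_norm \<alpha> \<beta> N n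
    * (\<Sum>k=0..n. hahn_coeff \<alpha> \<beta> N n k * pochhammer (- of_int x) k)"
  using assms by (simp add: hahn_def hahn_poly_def F32_partial_def hahn_norm_def hahn_coeff_def)

text \<open>As (-x)_n has leading coefficient (-1)^n, this gives P_n exact degree n, which justifies
  the later divisions by leading coefficients. The factor (-N)_n is nonzero because n \<le>
  N.\<close>

lemma hahn_leading_nonzero:
  assumes "n \<le> N" and "pochhammer (of_nat n + \<alpha> + \<beta> + 1) n \<noteq> 0" "pochhammer (\<alpha> + 1) n \<noteq> 0"
  shows "hahn_norm \<alpha> \<beta> N n * hahn_coeff \<alpha> \<beta> N n n \<noteq> 0"
proof -
  have "pochhammer (- of_nat N) n \<noteq> (0 :: complex)" "pochhammer (- of_nat n) n \<noteq> (0 :: complex)"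
    using assms(1) by (auto simp: pochhammer_of_nat_eq_0_iff)
  with assms(2,3) show ?thesis
    by (simp add: hahn_norm_def hahn_coeff_def)
qed

text \<open>The ratio of consecutive coefficients, using (k - n)(n + k + \<alpha> + \<beta> + 1) =
  lambda_k - lambda_n. The factor on the left is the off-diagonal entry of Y in the basis (-x)_k, in
  the form needed for the telescoping.\<close>

lemma hahn_coeff_Suc:
  assumes "\<alpha> + 1 \<noteq> - of_nat k" and "k < N"
  shows "hahn_coeff \<alpha> \<beta> N n (Suc k)
      * (- (of_nat k + 1) * (of_nat k - of_nat N) * (of_nat k + \<alpha> + 1))
    = (of_nat n * (of_nat n + \<alpha> + \<beta> + 1) - of_nat k * (of_nat k + \<alpha> + \<beta> + 1))
      * hahn_coeff \<alpha> \<beta> N n k"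
proof -
  let ?A = "\<alpha> + 1 + of_nat k" and ?B = "- of_nat N + of_nat k :: complex"
    and ?C = "1 + of_nat k :: complex"
  have nz: "?A \<noteq> 0" "?B \<noteq> 0" "?C \<noteq> 0"
    using assms by (auto simp: eq_neg_iff_add_eq_0 neg_eq_iff_add_eq_0)
      (metis of_nat_Suc of_nat_eq_0_iff nat.distinct(1))
  have "hahn_coeff \<alpha> \<beta> N n (Suc k) = hahn_coeff \<alpha> \<beta> N n k
      * ((- of_nat n + of_nat k) * (of_nat n + \<alpha> + \<beta> + 1 + of_nat k)) / (?A * ?B * ?C)"
    unfolding hahn_coeff_def pochhammer_Suc fact_Suc of_nat_Suc by (simp add: mult_ac)
  hence "hahn_coeff \<alpha> \<beta> N n (Suc k) * (?A * ?B * ?C) = hahn_coeff \<alpha> \<beta> N n k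
      * ((- of_nat n + of_nat k) * (of_nat n + \<alpha> + \<beta> + 1 + of_nat k))"
    using nz by simp
  moreover have "- (of_nat k + 1) * (of_nat k - of_nat N) * (of_nat k + \<alpha> + 1) = - (?A * ?B * ?C)"
    by (simp add: algebra_simps)
  ultimately show ?thesis
    by (simp only: mult_minus_right) (simp add: algebra_simps)
qed

text \<open>Truncating the series at \<open>m\<close> leaves a single residue in (-x)_m under Y -
  lambda_n: the next term cancels it and leaves its own residue in (-x)_{m+1}. \<open>S\<close> is a
  function of y = -x, so a shift x + 1 appears as -x - 1.\<close>

lemma hahn_partial_sum_eigen:
  fixes x \<alpha> \<beta> :: complex and N n m :: nat
  defines "S \<equiv> \<lambda>y. \<Sum>k=0..m. hahn_coeff \<alpha> \<beta> N n k * pochhammer y k"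
    and "L \<equiv> \<lambda>k::nat. of_nat k * (of_nat k + \<alpha> + \<beta> + 1) :: complex"
  assumes "\<forall>j<N. \<alpha> + 1 \<noteq> - of_nat j" and "m \<le> N"
  shows "(x - of_nat N) * (x + \<alpha> + 1) * (S (- x - 1) - S (- x))
       + x * (x - \<beta> - of_nat N - 1) * (S (1 - x) - S (- x)) - L n * S (- x)
       = - (L n - L m) * hahn_coeff \<alpha> \<beta> N n m * pochhammer (- x) m"
  using assms(4) unfolding S_def
proof (induction m)
  case 0
  then show ?case by (simp add: L_def)
next
  case (Suc m)
  let ?S = "\<lambda>y. \<Sum>k=0..m. hahn_coeff \<alpha> \<beta> N n k * pochhammer y k"
  let ?c = "hahn_coeff \<alpha> \<beta> N n (Suc m)"
  let ?p = "\<lambda>y. pochhammer y (Suc m)"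
  let ?B = "(x - of_nat N) * (x + \<alpha> + 1)" and ?D = "x * (x - \<beta> - of_nat N - 1)"
  let ?e = "- (of_nat m + 1) * (of_nat m - of_nat N) * (of_nat m + \<alpha> + 1)"
  have IH: "?B * (?S (- x - 1) - ?S (- x)) + ?D * (?S (1 - x) - ?S (- x)) - L n * ?S (- x)
      = - (L n - L m) * hahn_coeff \<alpha> \<beta> N n m * pochhammer (- x) m"
    using Suc by simp
  have step: "?B * (?p (- x - 1) - ?p (- x)) + ?D * (?p (1 - x) - ?p (- x))
      = L (Suc m) * ?p (- x) + ?e * pochhammer (- x) m"
    unfolding hahn_operator_pochhammer by (simp add: L_def algebra_simps)
  \<comment> \<open>This is the negative of the residue coefficient in \<open>IH\<close>, so the two
    terms in (-x)_m cancel.\<close>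
  have coeff: "?c * ?e = (L n - L m) * hahn_coeff \<alpha> \<beta> N n m"
    unfolding L_def using hahn_coeff_Suc assms(3) Suc.prems by simp
  have "?B * ((?S (- x - 1) + ?c * ?p (- x - 1)) - (?S (- x) + ?c * ?p (- x)))
      + ?D * ((?S (1 - x) + ?c * ?p (1 - x)) - (?S (- x) + ?c * ?p (- x)))
      - L n * (?S (- x) + ?c * ?p (- x))
    = (?B * (?S (- x - 1) - ?S (- x)) + ?D * (?S (1 - x) - ?S (- x)) - L n * ?S (- x))
      + ?c * (?B * (?p (- x - 1) - ?p (- x)) + ?D * (?p (1 - x) - ?p (- x))) - L n * ?c * ?p (- x)"
    by (simp only: ring_distribs mult_ac add_ac diff_conv_add_uminus minus_add_distrib
        mult_minus_left mult_minus_right)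
  also have "\<dots> = - ((L n - L m) * hahn_coeff \<alpha> \<beta> N n m) * pochhammer (- x) m
      + ?c * L (Suc m) * ?p (- x) + (?c * ?e) * pochhammer (- x) m - L n * ?c * ?p (- x)"
    unfolding IH step by (simp only: ring_distribs mult_ac add_ac mult_minus_left)
  also have "\<dots> = - (L n - L (Suc m)) * ?c * ?p (- x)"
    unfolding coeff by (simp add: ring_distribs)
  finally show ?case
    by simp
qed

text \<open>Valid for all integers \<open>n\<close> and \<open>x\<close>. Outside the index range
  \<open>hahn\<close> vanishes identically, so P_{-1} and P_{N+1} are covered as well.\<close>

lemma opY_hahn:
  assumes "\<forall>j<N. \<alpha> + 1 \<noteq> - of_nat j"
  shows "opY \<alpha> \<beta> N (hahn \<alpha> \<beta> N n) x = hahn_eigenvalue \<alpha> \<beta> n * hahn \<alpha> \<beta> N n x"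
proof (cases "0 \<le> n \<and> n \<le> int N")
  case True
  then obtain m where m: "n = int m" "m \<le> N"
    by (metis nonneg_int_cases of_nat_le_iff)
  define S where "S = (\<lambda>y. \<Sum>k=0..m. hahn_coeff \<alpha> \<beta> N m k * pochhammer y k)"
  define C where "C = hahn_norm \<alpha> \<beta> N m"
  have P: "hahn \<alpha> \<beta> N n z = C * S (- of_int z)" for z
    unfolding m(1) hahn_expansion[OF m(2)] C_def S_def ..
  let ?x = "of_int x :: complex"
  have shift: "- of_int (x + 1) = - ?x - 1" "- of_int (x - 1) = 1 - ?x"
    by simp_all
  have key: "coefB \<alpha> N x * (S (- ?x - 1) - S (- ?x)) + coefD \<beta> N x * (S (1 - ?x) - S (- ?x))
      = hahn_eigenvalue \<alpha> \<beta> n * S (- ?x)"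
    \<comment> \<open>Truncation at the degree itself makes the residue factor
      \<open>L n - L m\<close> zero.\<close>
    using hahn_partial_sum_eigen[OF assms m(2), of ?x \<beta> m]
    unfolding S_def coefB_def coefD_def hahn_eigenvalue_def m(1) by simp
  have "opY \<alpha> \<beta> N (hahn \<alpha> \<beta> N n) x
      = C * (coefB \<alpha> N x * (S (- ?x - 1) - S (- ?x)) + coefD \<beta> N x * (S (1 - ?x) - S (- ?x)))"
    unfolding opY_def diff_op_def P shift by (simp add: algebra_simps)
  then show ?thesis
    unfolding key P by simp
next
  case False
  then have "hahn \<alpha> \<beta> N n = (\<lambda>_. 0)"
    unfolding hahn_def by auto
  then show ?thesis
    by (simp add: opY_def diff_op_def)
qed

section \<open>Tridiagonality\<close>

text \<open>B(N) = 0 and D(0) = 0 hide the off-grid values. This allows the recurrence, known only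
  on the grid, to be substituted under Y.\<close>

lemma opY_cong_grid:
  assumes "x \<in> {0..int N}" and "\<And>y. y \<in> {0..int N} \<Longrightarrow> f y = g y"
  shows "opY \<alpha> \<beta> N f x = opY \<alpha> \<beta> N g x"
proof -
  have "coefB \<alpha> N x * f (x + 1) = coefB \<alpha> N x * g (x + 1)"
    using assms by (cases "x = int N") (auto simp: coefB_def)
  moreover have "coefD \<beta> N x * f (x - 1) = coefD \<beta> N x * g (x - 1)"
    using assms by (cases "x = 0") (auto simp: coefD_def)
  ultimately show ?thesis
    unfolding opY_def diff_op_def using assms by (simp only:)
qed

lemma opY_linear_combination:
  "opY \<alpha> \<beta> N (\<lambda>x. f x + b * g x + u * h x) x
    = opY \<alpha> \<beta> N f x + b * opY \<alpha> \<beta> N g x + u * opY \<alpha> \<beta> N h x"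
  by (simp add: opY_def diff_op_def algebra_simps)

text \<open>In XY the eigenvalue lambda_n comes out before the recurrence is applied; in YX each of
  the three recurrence terms receives its own eigenvalue. This is why \<tau>1 goes with
  \<open>l n\<close> throughout, and \<tau>2 with the eigenvalue of the resulting
  polynomial.\<close>

lemma opW_hahn:
  fixes \<alpha> \<beta> \<tau>0 \<tau>1 \<tau>2 \<tau>3 \<tau>4 :: complex and N :: nat
  defines "l \<equiv> hahn_eigenvalue \<alpha> \<beta>" and "P \<equiv> hahn \<alpha> \<beta> N"
  assumes "\<forall>j<N. \<alpha> + 1 \<noteq> - of_nat j" and rec: "hahn_recurrence_coeffs \<alpha> \<beta> N b u"
    and "n \<in> {0..int N}" and x: "x \<in> {0..int N}"
  shows "opW \<alpha> \<beta> N \<tau>0 \<tau>1 \<tau>2 \<tau>3 \<tau>4 (P n) x =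
      (\<tau>1 * l n + \<tau>2 * l (n + 1) + \<tau>3) * P (n + 1) x
      + ((\<tau>1 + \<tau>2) * l n * b n + \<tau>3 * b n + \<tau>4 * l n + \<tau>0) * P n x
      + (\<tau>2 * l (n - 1) + \<tau>1 * l n + \<tau>3) * u n * P (n - 1) x"
proof -
  have eigen: "opY \<alpha> \<beta> N (P k) y = l k * P k y" for k y
    unfolding P_def l_def by (rule opY_hahn[OF assms(3)])
  have X: "opX (P n) y = P (n + 1) y + b n * P n y + u n * P (n - 1) y" if "y \<in> {0..int N}" for y
    using rec that assms(5) unfolding hahn_recurrence_coeffs_def opX_def P_def by blast
  have "opY \<alpha> \<beta> N (opX (P n)) x
      = opY \<alpha> \<beta> N (\<lambda>y. P (n + 1) y + b n * P n y + u n * P (n - 1) y) x"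
    by (rule opY_cong_grid[OF x X])
  hence YX: "opY \<alpha> \<beta> N (opX (P n)) x
      = l (n + 1) * P (n + 1) x + b n * (l n * P n x) + u n * (l (n - 1) * P (n - 1) x)"
    by (simp add: opY_linear_combination eigen)
  have XY: "opX (opY \<alpha> \<beta> N (P n)) x = l n * opX (P n) x"
    by (simp add: opX_def eigen)
  show ?thesis
    unfolding opW_def XY YX eigen X[OF x] by (simp add: algebra_simps)
qed

section \<open>The converse\<close>

lemma hahn_0: "hahn \<alpha> \<beta> N 0 x = 1"
  by (simp add: hahn_def hahn_poly_def F32_partial_def)

lemma hahn_1_linear:
  assumes "N \<ge> 1" "\<alpha> + 1 \<noteq> 0" "\<alpha> + \<beta> + 2 \<noteq> 0"
  obtains p q where "p \<noteq> 0" "\<And>x. hahn \<alpha> \<beta> N 1 x = p * of_int x + q"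
proof
  define C c where "C = hahn_norm \<alpha> \<beta> N 1" and "c = hahn_coeff \<alpha> \<beta> N 1"
  show "- (C * c 1) \<noteq> 0"
    unfolding C_def c_def neg_equal_0_iff_equal
    by (rule hahn_leading_nonzero) (use assms in \<open>simp_all add: add_ac\<close>)
  show "hahn \<alpha> \<beta> N 1 x = - (C * c 1) * of_int x + C * c 0" for x
    using hahn_expansion[OF assms(1), of \<alpha> \<beta> x, folded C_def c_def] by (simp add: algebra_simps)
qed

lemma hahn_2_quadratic:
  assumes "N \<ge> 2" "\<alpha> + 1 \<noteq> 0" "\<alpha> + 2 \<noteq> 0" "\<alpha> + \<beta> + 3 \<noteq> 0" "\<alpha> + \<beta> + 4 \<noteq> 0"
  obtains p q r where "p \<noteq> 0" "\<And>x. hahn \<alpha> \<beta> N 2 x = p * of_int x ^ 2 + q * of_int x + r"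
proof
  define C c where "C = hahn_norm \<alpha> \<beta> N 2" and "c = hahn_coeff \<alpha> \<beta> N 2"
  have poch: "pochhammer y 2 = y * (y + 1)" for y :: complex
    by (simp add: eval_nat_numeral pochhammer_rec)
  show "C * c 2 \<noteq> 0"
    unfolding C_def c_def
    by (rule hahn_leading_nonzero) (use assms in \<open>simp_all add: poch add_ac\<close>)
  have "{0..2::nat} = {0, 1, 2}" by auto
  then show "hahn \<alpha> \<beta> N 2 x
      = C * c 2 * of_int x ^ 2 + (- C * (c 1 + c 2)) * of_int x + C * c 0" for x
    using hahn_expansion[OF assms(1), of \<alpha> \<beta> x, folded C_def c_def]
    by (simp add: poch algebra_simps power2_eq_square)
qed

text \<open>Only the degree bound is recorded: P_3 will occur just on the right-hand side of the
  relation for W P_2, where nothing is divided by its leading coefficient.\<close>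

lemma hahn_3_cubic:
  "\<exists>p q r s. \<forall>x. hahn \<alpha> \<beta> N 3 x = p * of_int x ^ 3 + q * of_int x ^ 2 + r * of_int x + s"
proof (cases "N \<ge> 3")
  case True
  define C c where "C = hahn_norm \<alpha> \<beta> N 3" and "c = hahn_coeff \<alpha> \<beta> N 3"
  have poch: "pochhammer y 2 = y * (y + 1)" "pochhammer y 3 = y * (y + 1) * (y + 2)" for y :: complex
    by (simp_all add: eval_nat_numeral pochhammer_rec)
  have "{0..3::nat} = {0, 1, 2, 3}" by auto
  \<comment> \<open>Collects powers using (-x)_2 = x^2 - x and (-x)_3 = -x^3 + 3 x^2 - 2 x.\<close>
  then have "hahn \<alpha> \<beta> N 3 x = (- C * c 3) * of_int x ^ 3 + C * (c 2 + 3 * c 3) * of_int x ^ 2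
      + (- C * (c 1 + c 2 + 2 * c 3)) * of_int x + C * c 0" for x
    using hahn_expansion[OF True, of \<alpha> \<beta> x, folded C_def c_def]
    by (simp add: poch algebra_simps power2_eq_square power3_eq_cube)
  then show ?thesis by blast
next
  case False
  then show ?thesis by (intro exI[of _ 0]) (simp add: hahn_def)
qed

section \<open>Polynomial form of the operator coefficients\<close>

text \<open>Synthetic division by x - z. The leading coefficient \<kappa> passes unchanged to the
  quotient, which keeps it common to \<open>A1\<close> and \<open>A2\<close>.\<close>

lemma factor_cubic_root:
  fixes z :: complex
  assumes "\<kappa> * z ^ 3 + a * z ^ 2 + b * z + c = 0"
  obtains \<mu>1 \<mu>0 where
    "\<And>x. \<kappa> * x ^ 3 + a * x ^ 2 + b * x + c = (x - z) * (\<kappa> * x ^ 2 + \<mu>1 * x + \<mu>0)"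
proof
  fix x
  have c: "c = - (\<kappa> * z ^ 3 + a * z ^ 2 + b * z)"
    using assms by algebra
  show "\<kappa> * x ^ 3 + a * x ^ 2 + b * x + c
      = (x - z) * (\<kappa> * x ^ 2 + (a + \<kappa> * z) * x + (b + a * z + \<kappa> * z ^ 2))"
    unfolding c by (simp add: algebra_simps power2_eq_square power3_eq_cube)
qed

text \<open>The first differences of \<open>P1\<close> and \<open>P2\<close> turn \<open>W1\<close>
  into an equation for A1 - A2 and \<open>W2\<close> into one for A1 + A2. Since A1 - A2 has degree
  at most 2, the half sum and half difference giving \<open>A1\<close> and \<open>A2\<close> share
  the cubic coefficient.\<close>

lemma diff_op_coeffs_cubic:
  fixes p1 p2 :: complex
  assumes P1: "\<And>x. P1 x = p1 * of_int x + q1" and "p1 \<noteq> 0"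
    and P2: "\<And>x. P2 x = p2 * of_int x ^ 2 + q2 * of_int x + r2" and "p2 \<noteq> 0"
    and P3: "\<And>x. P3 x = p3 * of_int x ^ 3 + q3 * of_int x ^ 2 + r3 * of_int x + s3"
    and W0: "\<And>x. x \<in> G \<Longrightarrow> A0 x = - A1 x - A2 x + t1 * of_int x + t0"
    and W1: "\<And>x. x \<in> G \<Longrightarrow> diff_op A1 A2 A0 P1 x = c2 * P2 x + c1 * P1 x + c0"
    and W2: "\<And>x. x \<in> G \<Longrightarrow> diff_op A1 A2 A0 P2 x = d3 * P3 x + d2 * P2 x + d1 * P1 x"
  shows "\<exists>\<kappa> a b c a' b' c'. \<forall>x\<in>G.
    A1 x = \<kappa> * of_int x ^ 3 + a * of_int x ^ 2 + b * of_int x + c \<and>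
    A2 x = \<kappa> * of_int x ^ 3 + a' * of_int x ^ 2 + b' * of_int x + c'"
proof -
  \<comment> \<open>The \<open>e\<close> values are the coefficients of A1 - A2, read off from p1
    (A1 - A2) = c2 P2 + c1 P1 + c0 - (t1 x + t0) P1.\<close>
  define e2 e1 e0 where "e2 = (c2 * p2 - t1 * p1) / p1"
    and "e1 = (c2 * q2 + c1 * p1 - t0 * p1 - t1 * q1) / p1"
    and "e0 = (c2 * r2 + c1 * q1 + c0 - t0 * q1) / p1"
  \<comment> \<open>Likewise for A1 + A2, whose equation also contains (2 p2 x + q2)(A1 - A2); hence
    the \<open>e\<close> values enter.\<close>
  define f3 f2 f1 f0 where "f3 = (d3 * p3 - t1 * p2 - 2 * p2 * e2) / p2"
    and "f2 = (d3 * q3 + d2 * p2 - t1 * q2 - t0 * p2 - 2 * p2 * e1 - q2 * e2) / p2"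
    and "f1 = (d3 * r3 + d2 * q2 + d1 * p1 - t1 * r2 - t0 * q2 - 2 * p2 * e0 - q2 * e1) / p2"
    and "f0 = (d3 * s3 + d2 * r2 + d1 * q1 - t0 * r2 - q2 * e0) / p2"
  have e: "p1 * e2 = c2 * p2 - t1 * p1" "p1 * e1 = c2 * q2 + c1 * p1 - t0 * p1 - t1 * q1"
    "p1 * e0 = c2 * r2 + c1 * q1 + c0 - t0 * q1"
    using \<open>p1 \<noteq> 0\<close> by (simp_all add: e2_def e1_def e0_def)
  have f: "p2 * f3 = d3 * p3 - t1 * p2 - 2 * p2 * e2"
    "p2 * f2 = d3 * q3 + d2 * p2 - t1 * q2 - t0 * p2 - 2 * p2 * e1 - q2 * e2"
    "p2 * f1 = d3 * r3 + d2 * q2 + d1 * p1 - t1 * r2 - t0 * q2 - 2 * p2 * e0 - q2 * e1"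
    "p2 * f0 = d3 * s3 + d2 * r2 + d1 * q1 - t0 * r2 - q2 * e0"
    using \<open>p2 \<noteq> 0\<close> by (simp_all add: f3_def f2_def f1_def f0_def)
  have diff: "A1 x - A2 x = e2 * of_int x ^ 2 + e1 * of_int x + e0" if "x \<in> G" for x
  proof -
    let ?x = "of_int x :: complex"
    have "p1 * (A1 x - A2 x)
        = c2 * P2 x + c1 * P1 x + c0 - (p1 * ?x + q1) * (t1 * ?x + t0)"
      using W1[OF that] unfolding diff_op_def W0[OF that] P1
      by (simp add: algebra_simps)
    also have "\<dots> = (p1 * e2) * ?x ^ 2 + (p1 * e1) * ?x + p1 * e0"
      unfolding P1 P2 e by (simp add: algebra_simps power2_eq_square)
    also have "\<dots> = p1 * (e2 * ?x ^ 2 + e1 * ?x + e0)"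
      by (simp add: algebra_simps)
    finally show ?thesis using \<open>p1 \<noteq> 0\<close> by (simp only: mult_cancel_left) simp
  qed
  have sum: "A1 x + A2 x = f3 * of_int x ^ 3 + f2 * of_int x ^ 2 + f1 * of_int x + f0"
    if "x \<in> G" for x
  proof -
    let ?x = "of_int x :: complex"
    have "p2 * (A1 x + A2 x)
        = d3 * P3 x + d2 * P2 x + d1 * P1 x
          - (p2 * ?x ^ 2 + q2 * ?x + r2) * (t1 * ?x + t0) - (2 * p2 * ?x + q2) * (A1 x - A2 x)"
      using W2[OF that] unfolding diff_op_def W0[OF that] P2
      by (simp add: algebra_simps power2_eq_square)
    also have "\<dots> = (p2 * f3) * ?x ^ 3 + (p2 * f2) * ?x ^ 2 + (p2 * f1) * ?x + p2 * f0"
      unfolding P1 P2 P3 f diff[OF that]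
      by (simp add: algebra_simps power2_eq_square power3_eq_cube)
    also have "\<dots> = p2 * (f3 * ?x ^ 3 + f2 * ?x ^ 2 + f1 * ?x + f0)"
      by (simp add: algebra_simps)
    finally show ?thesis using \<open>p2 \<noteq> 0\<close> by (simp only: mult_cancel_left) simp
  qed
  show ?thesis
  proof (intro exI ballI conjI)
    fix x assume x: "x \<in> G"
    have "A1 x = ((A1 x + A2 x) + (A1 x - A2 x)) / 2"
      by simp
    also have "\<dots> = f3 / 2 * of_int x ^ 3 + (f2 + e2) / 2 * of_int x ^ 2
        + (f1 + e1) / 2 * of_int x + (f0 + e0) / 2"
      unfolding sum[OF x] diff[OF x]
      by (simp add: add_divide_distrib diff_divide_distrib algebra_simps)
    finally show "A1 x = f3 / 2 * of_int x ^ 3 + (f2 + e2) / 2 * of_int x ^ 2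
        + (f1 + e1) / 2 * of_int x + (f0 + e0) / 2" .
    have "A2 x = ((A1 x + A2 x) - (A1 x - A2 x)) / 2"
      by simp
    also have "\<dots> = f3 / 2 * of_int x ^ 3 + (f2 - e2) / 2 * of_int x ^ 2
        + (f1 - e1) / 2 * of_int x + (f0 - e0) / 2"
      unfolding sum[OF x] diff[OF x]
      by (simp add: add_divide_distrib diff_divide_distrib algebra_simps)
    finally show "A2 x = f3 / 2 * of_int x ^ 3 + (f2 - e2) / 2 * of_int x ^ 2
        + (f1 - e1) / 2 * of_int x + (f0 - e0) / 2" .
  qed
qed

text \<open>Newton interpolation at 0, 1, 2, which contain the whole grid; a value of
  \<open>A\<close> off the grid may enter harmlessly. The zero cubic term makes the result fit the
  general shape with \<kappa> = 0.\<close>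

lemma quadratic_interpolation:
  fixes A :: "int \<Rightarrow> complex"
  assumes "N \<le> (2::nat)"
  obtains a b c where "\<And>x. x \<in> {0..int N} \<Longrightarrow> A x = 0 * of_int x ^ 3 + a * of_int x ^ 2 + b * of_int x + c"
proof (rule that)
  fix x assume "x \<in> {0..int N}"
  with assms have "x = 0 \<or> x = 1 \<or> x = 2" by auto
  then show "A x = 0 * of_int x ^ 3 + (A 2 - 2 * A 1 + A 0) / 2 * of_int x ^ 2
      + (4 * A 1 - 3 * A 0 - A 2) / 2 * of_int x + A 0"
    by (auto simp: field_simps)
qed

lemma tridiagonal_operator_form:
  fixes A1 A2 A0 :: "int \<Rightarrow> complex" and \<alpha> \<beta> :: complex and N :: nat
  defines "P \<equiv> hahn \<alpha> \<beta> N"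
  assumes N: "N \<ge> 1" and \<alpha>: "\<forall>j<N. \<alpha> + 1 \<noteq> - of_nat j"
    and \<alpha>\<beta>: "\<forall>j\<in>{2..2 * N}. \<alpha> + \<beta> + of_nat j \<noteq> 0"
    and A1N: "A1 (int N) = 0" and A20: "A2 0 = 0"
    and tri: "\<forall>n\<in>{0..int N}. \<exists>c1 c0 c2 :: complex. \<forall>x\<in>{0..int N}.
          diff_op A1 A2 A0 (P n) x = c1 * P (n + 1) x + c0 * P n x + c2 * P (n - 1) x"
  shows "\<exists>\<kappa> \<mu>0 \<mu>1 \<nu>0 \<nu>1 r0 r1 :: complex. \<forall>x\<in>{0..int N}.
          A1 x = (of_int x - of_nat N) * (\<kappa> * of_int x ^ 2 + \<mu>1 * of_int x + \<mu>0) \<and>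
          A2 x = of_int x * (\<kappa> * of_int x ^ 2 + \<nu>1 * of_int x + \<nu>0) \<and>
          A0 x = - A1 x - A2 x + r1 * of_int x + r0"
proof -
  have P0: "P 0 x = 1" for x
    unfolding P_def by (rule hahn_0)
  have "\<alpha> + 1 \<noteq> 0"
    using \<alpha>[rule_format, of 0] N by simp
  moreover have "\<alpha> + \<beta> + 2 \<noteq> 0"
    using \<alpha>\<beta>[rule_format, of 2] N by simp
  ultimately obtain p1 q1 where p1: "p1 \<noteq> 0" and P1: "\<And>x. P 1 x = p1 * of_int x + q1"
    unfolding P_def using hahn_1_linear[OF N] by blast
  obtain c1 c0 c2 where
    "\<forall>x\<in>{0..int N}. diff_op A1 A2 A0 (P 0) x = c1 * P 1 x + c0 * P 0 x + c2 * P (- 1) x"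
    using tri[rule_format, of 0] by auto
  moreover have "P (- 1) x = 0" for x
    by (simp add: P_def hahn_def)
  \<comment> \<open>P_0 = 1, so W P_0 is A0 + A1 + A2, and it is linear because P_{-1} = 0.\<close>
  ultimately have W0: "A0 x = - A1 x - A2 x + c1 * p1 * of_int x + (c1 * q1 + c0)"
    if "x \<in> {0..int N}" for x
    using that by (fastforce simp: diff_op_def P0 P1 algebra_simps)
  obtain \<kappa> a b c a' b' c' where
    A1: "\<And>x. x \<in> {0..int N} \<Longrightarrow> A1 x = \<kappa> * of_int x ^ 3 + a * of_int x ^ 2 + b * of_int x + c" and
    A2: "\<And>x. x \<in> {0..int N} \<Longrightarrow> A2 x = \<kappa> * of_int x ^ 3 + a' * of_int x ^ 2 + b' * of_int x + c'"
  proof (cases "N \<le> 2")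
    \<comment> \<open>Both coefficients are interpolated by quadratics, so \<kappa> = 0 serves them
      together.\<close>
    case True
    show ?thesis
      by (rule quadratic_interpolation[OF True, of A1], rule quadratic_interpolation[OF True, of A2])
        (rule that)
  next
    case False
    \<comment> \<open>Now N \<ge> 3, so the parameter conditions reach far enough to give P_2 exact
      degree 2.\<close>
    have "\<alpha> + 2 \<noteq> 0"
      using \<alpha>[rule_format, of 1] False by (simp add: eq_neg_iff_add_eq_0 add.assoc)
    moreover have "\<alpha> + \<beta> + 3 \<noteq> 0" "\<alpha> + \<beta> + 4 \<noteq> 0"
      using \<alpha>\<beta>[rule_format, of 3] \<alpha>\<beta>[rule_format, of 4] False by simp_all
    ultimately obtain p2 q2 r2 where p2: "p2 \<noteq> 0"
      and P2: "\<And>x. P 2 x = p2 * of_int x ^ 2 + q2 * of_int x + r2"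
      unfolding P_def using hahn_2_quadratic[of N \<alpha> \<beta>] \<open>\<alpha> + 1 \<noteq> 0\<close> False by (metis nat_le_linear)
    obtain p3 q3 r3 s3 where
      P3: "\<And>x. P 3 x = p3 * of_int x ^ 3 + q3 * of_int x ^ 2 + r3 * of_int x + s3"
      unfolding P_def using hahn_3_cubic[of \<alpha> \<beta> N] by blast
    obtain d2 d1 d0 where W1:
      "\<And>x. x \<in> {0..int N} \<Longrightarrow> diff_op A1 A2 A0 (P 1) x = d2 * P 2 x + d1 * P 1 x + d0"
      \<comment> \<open>The P_0 term of the three-term combination is the constant
        \<open>d0\<close>.\<close>
      using tri[rule_format, of 1] False by (auto simp: P0)
    obtain e3 e2 e1 where W2:
      "\<And>x. x \<in> {0..int N} \<Longrightarrow> diff_op A1 A2 A0 (P 2) x = e3 * P 3 x + e2 * P 2 x + e1 * P 1 x"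
      using tri[rule_format, of 2] False by auto
    show ?thesis
      using diff_op_coeffs_cubic[where G = "{0..int N}", OF P1 p1 P2 p2 P3 W0 W1 W2] that by blast
  qed
  \<comment> \<open>The boundary condition at N makes N a root of the cubic for \<open>A1\<close>;
    the one at 0 removes the constant term for \<open>A2\<close>.\<close>
  obtain \<mu>1 \<mu>0 where \<mu>: "\<And>x. \<kappa> * x ^ 3 + a * x ^ 2 + b * x + c
      = (x - of_nat N) * (\<kappa> * x ^ 2 + \<mu>1 * x + \<mu>0)"
    using factor_cubic_root[of \<kappa> "of_nat N" a b c] A1[of "int N"] A1N by auto
  have "c' = 0"
    using A2[of 0] A20 by simp
  then have "A2 x = of_int x * (\<kappa> * of_int x ^ 2 + a' * of_int x + b')" if "x \<in> {0..int N}" for x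
    using A2[OF that] by (simp add: algebra_simps power2_eq_square power3_eq_cube)
  moreover have "A1 x = (of_int x - of_nat N) * (\<kappa> * of_int x ^ 2 + \<mu>1 * of_int x + \<mu>0)"
    if "x \<in> {0..int N}" for x
    using A1[OF that] \<mu> by simp
  ultimately show ?thesis
    using W0 by blast
qed

theorem mainTheorem4:
  fixes N :: nat and \<alpha> \<beta> :: complex
  assumes "N \<ge> 1"
    and "\<forall>j<N. \<alpha> + 1 \<noteq> - of_nat j"
    and "\<forall>j\<in>{2..2 * N}. \<alpha> + \<beta> + of_nat j \<noteq> 0"
  defines "P \<equiv> hahn \<alpha> \<beta> N"
    and "l \<equiv> hahn_eigenvalue \<alpha> \<beta>"
  shows
    "(\<forall>b u. hahn_recurrence_coeffs \<alpha> \<beta> N b u \<longrightarrow>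
       (\<forall>\<tau>0 \<tau>1 \<tau>2 \<tau>3 \<tau>4 :: complex.
         let \<xi> = (\<lambda>n. \<tau>1 * l (n - 1) + \<tau>2 * l n + \<tau>3);
             \<zeta> = (\<lambda>n. \<tau>2 * l (n - 1) + \<tau>1 * l n + \<tau>3);
             \<eta> = (\<lambda>n. (\<tau>1 + \<tau>2) * l n * b n + \<tau>3 * b n + \<tau>4 * l n + \<tau>0)
         in \<forall>n\<in>{0..int N}. \<forall>x\<in>{0..int N}.
              opW \<alpha> \<beta> N \<tau>0 \<tau>1 \<tau>2 \<tau>3 \<tau>4 (P n) x =
                \<xi> (n + 1) * P (n + 1) x + \<eta> n * P n x + \<zeta> n * u n * P (n - 1) x))
     \<and>
     (\<forall>A1 A2 A0 :: int \<Rightarrow> complex.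
       A1 (int N) = 0 \<longrightarrow> A2 0 = 0 \<longrightarrow>
       (\<forall>n\<in>{0..int N}. \<exists>c1 c0 c2 :: complex. \<forall>x\<in>{0..int N}.
          diff_op A1 A2 A0 (P n) x = c1 * P (n + 1) x + c0 * P n x + c2 * P (n - 1) x) \<longrightarrow>
       (\<exists>\<kappa> \<mu>0 \<mu>1 \<nu>0 \<nu>1 r0 r1 :: complex. \<forall>x\<in>{0..int N}.
          A1 x = (of_int x - of_nat N) * (\<kappa> * of_int x ^ 2 + \<mu>1 * of_int x + \<mu>0) \<and>
          A2 x = of_int x * (\<kappa> * of_int x ^ 2 + \<nu>1 * of_int x + \<nu>0) \<and>
          A0 x = - A1 x - A2 x + r1 * of_int x + r0))"
proof (intro conjI allI impI)
  fix b u and \<tau>0 \<tau>1 \<tau>2 \<tau>3 \<tau>4 :: complex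
  assume "hahn_recurrence_coeffs \<alpha> \<beta> N b u"
  then show "let \<xi> = (\<lambda>n. \<tau>1 * l (n - 1) + \<tau>2 * l n + \<tau>3);
             \<zeta> = (\<lambda>n. \<tau>2 * l (n - 1) + \<tau>1 * l n + \<tau>3);
             \<eta> = (\<lambda>n. (\<tau>1 + \<tau>2) * l n * b n + \<tau>3 * b n + \<tau>4 * l n + \<tau>0)
         in \<forall>n\<in>{0..int N}. \<forall>x\<in>{0..int N}.
              opW \<alpha> \<beta> N \<tau>0 \<tau>1 \<tau>2 \<tau>3 \<tau>4 (P n) x =
                \<xi> (n + 1) * P (n + 1) x + \<eta> n * P n x + \<zeta> n * u n * P (n - 1) x"
    unfolding Let_def P_def l_def using opW_hahn[OF assms(2)] by simp
next
  fix A1 A2 A0 :: "int \<Rightarrow> complex"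
  assume "A1 (int N) = 0" "A2 0 = 0"
    "\<forall>n\<in>{0..int N}. \<exists>c1 c0 c2 :: complex. \<forall>x\<in>{0..int N}.
          diff_op A1 A2 A0 (P n) x = c1 * P (n + 1) x + c0 * P n x + c2 * P (n - 1) x"
  then show "\<exists>\<kappa> \<mu>0 \<mu>1 \<nu>0 \<nu>1 r0 r1 :: complex. \<forall>x\<in>{0..int N}.
          A1 x = (of_int x - of_nat N) * (\<kappa> * of_int x ^ 2 + \<mu>1 * of_int x + \<mu>0) \<and>
          A2 x = of_int x * (\<kappa> * of_int x ^ 2 + \<nu>1 * of_int x + \<nu>0) \<and>
          A0 x = - A1 x - A2 x + r1 * of_int x + r0"
    unfolding P_def by (rule tridiagonal_operator_form[OF assms(1-3)])
qed

end
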